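(* For every $n\ge1$, the six bistatistics $(\mathrm{pex},\mathrm{ear})$, $(\mathrm{ear},\mathrm{pex})$, $(\mathrm{ear},\mathrm{pcyc})$, $(\mathrm{pcyc},\mathrm{ear})$, $(\mathrm{pex},\mathrm{pcyc})$ and $(\mathrm{pcyc},\mathrm{pex})$ are equidistributed on $\mathfrak S_n$; that is, the polynomial $\sum_{\sigma\in\mathfrak S_n}x^{s_1(\sigma)}y^{s_2(\sigma)}$ is the same for each of these six pairs $(s_1,s_2)$.
   Context: $\mathfrak S_n$ is the set of permutations of $[n]=\{1,\dots,n\}$. For $\sigma\in\mathfrak S_n$: - $\mathrm{pex}\,\sigma$ is the number of pure excedances, i.e. $i$ such that $\sigma(i)>i$ and $\sigma(j)\notin[i,\sigma(i)]$ for all $j<i$. - $\mathrm{pcyc}\,\sigma=\mathrm{cyc}\,\sigma-\mathrm{fix}\,\sigma$, where $\mathrm{cyc}\,\sigma$ is the number of cycles (fixed points included) and $\mathrm{fix}\,\sigma$ the number of fixed points. - An index $i$ is a record if $\sigma(j)<\sigma(i)$ for all $j<i$; an antirecord if $\sigma(j)>\sigma(i)$ for all $j>i$; an exclusive antirecord if it is an antirecord and not a record; a cycle peak if $\sigma^{-1}(i)<i>\sigma(i)$. $\mathrm{ear}\,\sigma$ is the number of $i\in[n]$ that are both an exclusive antirecord and a cycle peak. *)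

theory Defs
  imports "HOL-Combinatorics.Orbits" "HOL-Computational_Algebra.Polynomial"
begin

text \<open>
  A permutation of \<open>[n]\<close> is a function \<open>\<sigma> :: nat \<Rightarrow> nat\<close> with \<open>\<sigma> permutes {1..n}\<close>. It fixes
  every number outside \<open>{1..n}\<close>, so the ambient \<open>n\<close> is a parameter of the notions below and every
  index is explicitly confined to \<open>{1..n}\<close>.
\<close>

definition pure_excedance :: "nat \<Rightarrow> (nat \<Rightarrow> nat) \<Rightarrow> nat \<Rightarrow> bool" where
  "pure_excedance n \<sigma> i \<longleftrightarrow>
     i \<in> {1..n} \<and> \<sigma> i > i \<and> (\<forall>j\<in>{1..<i}. \<sigma> j \<notin> {i..\<sigma> i})"

definition pex :: "nat \<Rightarrow> (nat \<Rightarrow> nat) \<Rightarrow> nat" where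
  "pex n \<sigma> = card {i. pure_excedance n \<sigma> i}"

definition cyc :: "nat \<Rightarrow> (nat \<Rightarrow> nat) \<Rightarrow> nat" where
  "cyc n \<sigma> = card (orbit \<sigma> ` {1..n})"

definition fixpts :: "nat \<Rightarrow> (nat \<Rightarrow> nat) \<Rightarrow> nat" where
  "fixpts n \<sigma> = card {i \<in> {1..n}. \<sigma> i = i}"

text \<open>
  The subtraction below does not truncate: distinct fixed points have distinct orbits, so
  \<open>fixpts n \<sigma> \<le> cyc n \<sigma>\<close>.
\<close>

definition pcyc :: "nat \<Rightarrow> (nat \<Rightarrow> nat) \<Rightarrow> nat" where
  "pcyc n \<sigma> = cyc n \<sigma> - fixpts n \<sigma>"

definition is_record :: "nat \<Rightarrow> (nat \<Rightarrow> nat) \<Rightarrow> nat \<Rightarrow> bool" where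
  "is_record n \<sigma> i \<longleftrightarrow> i \<in> {1..n} \<and> (\<forall>j\<in>{1..<i}. \<sigma> j < \<sigma> i)"

definition antirecord :: "nat \<Rightarrow> (nat \<Rightarrow> nat) \<Rightarrow> nat \<Rightarrow> bool" where
  "antirecord n \<sigma> i \<longleftrightarrow> i \<in> {1..n} \<and> (\<forall>j\<in>{i<..n}. \<sigma> j > \<sigma> i)"

definition exclusive_antirecord :: "nat \<Rightarrow> (nat \<Rightarrow> nat) \<Rightarrow> nat \<Rightarrow> bool" where
  "exclusive_antirecord n \<sigma> i \<longleftrightarrow> antirecord n \<sigma> i \<and> \<not> is_record n \<sigma> i"

definition cycle_peak :: "nat \<Rightarrow> (nat \<Rightarrow> nat) \<Rightarrow> nat \<Rightarrow> bool" where
  "cycle_peak n \<sigma> i \<longleftrightarrow> i \<in> {1..n} \<and> inv \<sigma> i < i \<and> i > \<sigma> i"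

definition ear :: "nat \<Rightarrow> (nat \<Rightarrow> nat) \<Rightarrow> nat" where
  "ear n \<sigma> = card {i. exclusive_antirecord n \<sigma> i \<and> cycle_peak n \<sigma> i}"

text \<open>
  Bivariate integer polynomials are represented as \<open>\<int>[y][x]\<close>: the outer indeterminate is \<open>x\<close> and
  the indeterminate of the coefficients is \<open>y\<close>.
\<close>

definition var_x :: "int poly poly" where
  "var_x = [:0, 1:]"

definition var_y :: "int poly poly" where
  "var_y = [:[:0, 1:]:]"

definition bistat_poly ::
    "nat \<Rightarrow> (nat \<Rightarrow> (nat \<Rightarrow> nat) \<Rightarrow> nat) \<Rightarrow> (nat \<Rightarrow> (nat \<Rightarrow> nat) \<Rightarrow> nat) \<Rightarrow> int poly poly" where
  "bistat_poly n s\<^sub>1 s\<^sub>2 = (\<Sum>\<sigma> | \<sigma> permutes {1..n}. var_x ^ s\<^sub>1 n \<sigma> * var_y ^ s\<^sub>2 n \<sigma>)"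

end

theory Submission
  imports Defs
begin

text \<open>
  Each of the pairs \<open>(pex, ear)\<close>, \<open>(ear, pcyc)\<close>, \<open>(pex, pcyc)\<close> is distributed according to the
  continued fraction with coefficients \<open>2k + 1\<close> and \<open>(k + x) (k + y)\<close>, which is symmetric in \<open>x\<close>
  and \<open>y\<close>.

  For the pairs involving \<open>pcyc\<close>, build the permutation by adding the elements of \<open>{1..n}\<close> one at a
  time, keeping a partial injection that consists of cycles and \<open>k\<close> open paths. An element linked
  on both sides chooses the initial point \<open>b\<close> and the terminal point \<open>a\<close> of a path; exactly one \<open>a\<close>
  closes a cycle, and exactly one \<open>b\<close> is least. The latter event is counted by \<open>ear\<close> when the
  elements arrive in the order \<open>1, \<dots>, n\<close>, and by \<open>pex\<close> in the order \<open>n, \<dots>, 1\<close>.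

  For \<open>(pex, ear)\<close>, add positions from left to right and remember the relative order of the \<open>k\<close>
  values that exceed the current position. This multiplies the weight by \<open>x (x + 1) \<dots> (x + k - 1)\<close>,
  since an excedance whose position is not an earlier value is pure for exactly one rank of its value.
\<close>

section \<open>Partial injections\<close>

text \<open>A set of pairs rather than a partial function: inversion is \<open>converse\<close>, and
  adding a link is \<open>insert\<close>.\<close>

definition pinj :: "'a set \<Rightarrow> 'b set \<Rightarrow> ('a \<times> 'b) set set" where
  "pinj X Y = {r. r \<subseteq> X \<times> Y \<and> single_valued r \<and> single_valued (r\<inverse>)}"

lemma finite_pinj: "finite X \<Longrightarrow> finite Y \<Longrightarrow> finite (pinj X Y)"
  unfolding pinj_def by (rule finite_subset[of _ "Pow (X \<times> Y)"]) auto

lemma pinj_finite: "finite X \<Longrightarrow> finite Y \<Longrightarrow> r \<in> pinj X Y \<Longrightarrow> finite r"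
  unfolding pinj_def by (auto intro: finite_subset)

lemma pinj_converse: "r\<inverse> \<in> pinj Y X \<longleftrightarrow> r \<in> pinj X Y"
  unfolding pinj_def by auto

text \<open>Either \<open>z\<close> has no outgoing link, or deleting its unique outgoing link
  leaves a partial injection on \<open>X\<close> together with a free end point
  \<open>b\<close>.\<close>

lemma sum_pinj_insert_left:
  fixes w :: "('a \<times> 'b) set \<Rightarrow> 'c::comm_monoid_add"
  assumes fin: "finite X" "finite Y" and z: "z \<notin> X"
  shows "(\<Sum>r\<in>pinj (insert z X) Y. w r) =
    (\<Sum>r\<in>pinj X Y. w r + (\<Sum>b\<in>Y - Range r. w (insert (z, b) r)))"
proof -
  let ?S = "{r \<in> pinj (insert z X) Y. z \<in> Domain r}"
  have "pinj (insert z X) Y = pinj X Y \<union> ?S"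
    unfolding pinj_def by auto
  moreover have "pinj X Y \<inter> ?S = {}"
    unfolding pinj_def using z by auto
  ultimately have "(\<Sum>r\<in>pinj (insert z X) Y. w r) = (\<Sum>r\<in>pinj X Y. w r) + (\<Sum>r\<in>?S. w r)"
    using fin by (metis (no_types, lifting) finite_Un finite_insert finite_pinj sum.union_disjoint)
  also have "(\<Sum>r\<in>?S. w r) =
      (\<Sum>(r, b)\<in>Sigma (pinj X Y) (\<lambda>r. Y - Range r). w (insert (z, b) r))"
  proof (rule sum.reindex_bij_witness[where j = "\<lambda>r. (r \<inter> X \<times> UNIV, THE b. (z, b) \<in> r)"
        and i = "\<lambda>(r, b). insert (z, b) r"])
    fix r assume r: "r \<in> ?S"
    then obtain b where b: "(z, b) \<in> r" by auto
    have sv: "single_valued r" "single_valued (r\<inverse>)" and sub: "r \<subseteq> insert z X \<times> Y"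
      using r unfolding pinj_def by auto
    have the: "(THE b. (z, b) \<in> r) = b"
      using b sv by (auto simp: single_valued_def)
    have eq: "insert (z, b) (r \<inter> X \<times> UNIV) = r"
    proof (intro equalityI subsetI)
      fix q assume q: "q \<in> r"
      then obtain u v where uv: "q = (u, v)" "u \<in> insert z X" "(u, v) \<in> r" using sub by auto
      with single_valuedD[OF sv(1) b, of v] show "q \<in> insert (z, b) (r \<inter> X \<times> UNIV)" by auto
    qed (use b in auto)
    have "b \<notin> Range (r \<inter> X \<times> UNIV)"
    proof
      assume "b \<in> Range (r \<inter> X \<times> UNIV)"
      then obtain u where "u \<in> X" "(u, b) \<in> r" by auto
      with single_valuedD[OF sv(2), of b z u] b z show False by auto
    qed
    moreover have "r \<inter> X \<times> UNIV \<in> pinj X Y"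
      using sv sub unfolding pinj_def single_valued_def by auto
    ultimately show "(r \<inter> X \<times> UNIV, THE b. (z, b) \<in> r) \<in> Sigma (pinj X Y) (\<lambda>r. Y - Range r)"
      using the b sub by auto
    show "(\<lambda>(r, b). insert (z, b) r) (r \<inter> X \<times> UNIV, THE b. (z, b) \<in> r) = r"
      by (simp add: the eq)
    show "(\<lambda>(r, b). w (insert (z, b) r)) (r \<inter> X \<times> UNIV, THE b. (z, b) \<in> r) = w r"
      by (simp add: the eq)
  next
    fix p assume "p \<in> Sigma (pinj X Y) (\<lambda>r. Y - Range r)"
    then obtain r b where p: "p = (r, b)" and r: "r \<in> pinj X Y" and b: "b \<in> Y" "b \<notin> Range r"
      by auto
    have zr: "z \<notin> Domain r" using r z unfolding pinj_def by auto
    have "(THE c. (z, c) \<in> insert (z, b) r) = b"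
      using zr by auto
    moreover have "insert (z, b) r \<inter> X \<times> UNIV = r"
      using r z unfolding pinj_def by auto
    ultimately show "((\<lambda>(r, b). insert (z, b) r) p \<inter> X \<times> UNIV,
        THE c. (z, c) \<in> (\<lambda>(r, b). insert (z, b) r) p) = p"
      by (simp add: p)
    show "(\<lambda>(r, b). insert (z, b) r) p \<in> ?S"
      using r b zr unfolding p pinj_def single_valued_def by auto
  qed
  also have "\<dots> = (\<Sum>r\<in>pinj X Y. \<Sum>b\<in>Y - Range r. w (insert (z, b) r))"
    using fin by (subst sum.Sigma) (auto simp: finite_pinj)
  finally show ?thesis by (simp add: sum.distrib)
qed

lemma sum_pinj_insert_right:
  fixes w :: "('a \<times> 'b) set \<Rightarrow> 'c::comm_monoid_add"
  assumes fin: "finite X" "finite Y" and z: "z \<notin> Y"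
  shows "(\<Sum>r\<in>pinj X (insert z Y). w r) =
    (\<Sum>r\<in>pinj X Y. w r + (\<Sum>a\<in>X - Domain r. w (insert (a, z) r)))"
proof -
  have conv: "(\<Sum>r\<in>pinj X Z. f r) = (\<Sum>r\<in>pinj Z X. f (r\<inverse>))" for Z and f :: "_ \<Rightarrow> 'c"
    by (rule sum.reindex_bij_witness[where i = converse and j = converse])
      (auto simp: pinj_converse)
  have ins: "(insert (z, b) r)\<inverse> = insert (b, z) (r\<inverse>)" for b r by auto
  show ?thesis
    unfolding conv using sum_pinj_insert_left[OF fin(2,1) z, of "\<lambda>r. w (r\<inverse>)"]
    by (simp only: ins Domain_converse)
qed

text \<open>
  The five summands correspond to \<open>z\<close> being isolated, a fixed point, a terminal point of a path,
  an initial point of a path, or linked on both sides.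
\<close>

lemma sum_pinj_insert:
  fixes w :: "'a rel \<Rightarrow> 'c::comm_monoid_add"
  assumes fin: "finite A" and z: "z \<notin> A"
  shows "(\<Sum>r\<in>pinj (insert z A) (insert z A). w r) = (\<Sum>r\<in>pinj A A.
     w r + w (insert (z, z) r) + (\<Sum>a\<in>A - Domain r. w (insert (a, z) r))
     + (\<Sum>b\<in>A - Range r. w (insert (z, b) r))
     + (\<Sum>a\<in>A - Domain r. \<Sum>b\<in>A - Range r. w (insert (z, b) (insert (a, z) r))))"
proof -
  have zr: "z \<notin> Range r" if "r \<in> pinj A A" for r
    using that z unfolding pinj_def by auto
  have 1: "insert z A - Range r = insert z (A - Range r)" if "r \<in> pinj A A" for r
    using zr[OF that] by auto
  \<comment> \<open>A link from \<open>a\<close> uses up the end point \<open>z\<close>, so the loop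
    at \<open>z\<close> occurs only in the case where \<open>z\<close> has no incoming link from
    \<open>A\<close>.\<close>
  have 2: "insert z A - Range (insert (a, z) r) = A - Range r" for a r
    using z by auto
  have "(\<Sum>r\<in>pinj (insert z A) (insert z A). w r) = (\<Sum>r\<in>pinj A (insert z A).
      w r + (\<Sum>b\<in>insert z A - Range r. w (insert (z, b) r)))"
    by (rule sum_pinj_insert_left) (use assms in auto)
  also have "\<dots> = (\<Sum>r\<in>pinj A A. w r + (\<Sum>b\<in>insert z A - Range r. w (insert (z, b) r))
      + (\<Sum>a\<in>A - Domain r. w (insert (a, z) r)
          + (\<Sum>b\<in>insert z A - Range (insert (a, z) r). w (insert (z, b) (insert (a, z) r)))))"
    by (rule sum_pinj_insert_right) (use assms in auto)
  also have "\<dots> = (\<Sum>r\<in>pinj A A.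
     w r + w (insert (z, z) r) + (\<Sum>a\<in>A - Domain r. w (insert (a, z) r))
     + (\<Sum>b\<in>A - Range r. w (insert (z, b) r))
     + (\<Sum>a\<in>A - Domain r. \<Sum>b\<in>A - Range r. w (insert (z, b) (insert (a, z) r))))"
    using fin z by (intro sum.cong refl) (simp only: 2, simp add: 1 sum.distrib add_ac)
  finally show ?thesis .
qed

text \<open>Both projections are injective on \<open>r\<close>. The common value
  \<open>card A - card r\<close> is the number of open paths, counted by their terminal points
  \<open>A - Domain r\<close> or their initial points \<open>A - Range r\<close>; an isolated point
  is a path of its own.\<close>

lemma pinj_card_Diff:
  assumes "finite A" and r: "r \<in> pinj A A"
  shows "card (A - Domain r) = card A - card r" and "card (A - Range r) = card A - card r"
    and "card r \<le> card A"
proof -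
  have sub: "Domain r \<subseteq> A" "Range r \<subseteq> A" using r unfolding pinj_def by auto
  have sv: "single_valued r" "single_valued (r\<inverse>)" using r unfolding pinj_def by auto
  have "card (Domain r) = card r"
    using sv(1) unfolding Domain_fst by (intro card_image) (auto simp: inj_on_def single_valued_def)
  moreover have "card (Range r) = card r"
    using sv(2) unfolding Range_snd by (intro card_image) (auto simp: inj_on_def single_valued_def)
  ultimately show "card (A - Domain r) = card A - card r" "card (A - Range r) = card A - card r"
    "card r \<le> card A"
    using sub assms(1) by (metis card_Diff_subset finite_subset, metis card_Diff_subset finite_subset,
      metis card_mono)
qed

section \<open>Cycles and open paths of a partial injection\<close>

text \<open>A cycle is encoded by its vertex set. Excluding loops leaves the cycles that
  \<open>pcyc\<close> counts.\<close>

definition nontrivial_cycles :: "'a rel \<Rightarrow> 'a set set" where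
  "nontrivial_cycles r = {r\<^sup>+ `` {x} |x. (x, x) \<in> r\<^sup>+ \<and> (x, x) \<notin> r}"

lemma finite_nontrivial_cycles:
  assumes "finite r"
  shows "finite (nontrivial_cycles r)"
proof -
  have "nontrivial_cycles r \<subseteq> (\<lambda>x. r\<^sup>+ `` {x}) ` Domain r"
    unfolding nontrivial_cycles_def by (blast dest: tranclD)
  then show ?thesis
    by (rule finite_subset) (simp add: assms finite_Domain)
qed

text \<open>Successors are unique, so a walk that starts on a cycle never leaves it: each step is
  the step of the cycle.\<close>

lemma cyclic_reaches_cyclic:
  assumes "single_valued r" "(x, p) \<in> r\<^sup>*" "(x, x) \<in> r\<^sup>+"
  shows "(p, p) \<in> r\<^sup>+"
  using assms(2,3)
proof (induction rule: rtrancl_induct)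
  case (step y z)
  then obtain u where "(y, u) \<in> r" "(u, y) \<in> r\<^sup>*" by (auto dest: tranclD)
  with step.hyps(2) assms(1) have "(z, y) \<in> r\<^sup>*"
    by (auto simp: single_valued_def)
  with step.hyps(2) show ?case by auto
qed

text \<open>The new link joins a terminal point \<open>p\<close> to an initial point
  \<open>q\<close>. Neither lies on an old cycle, so old cycles survive unchanged, and a new one
  arises exactly when the path starting at \<open>q\<close> ends at \<open>p\<close>;
  \<open>p = q\<close> gives a loop only. The second claim says that the new cycle is not an old
  one, as needed for counting.\<close>

lemma nontrivial_cycles_insert:
  assumes sv: "single_valued r" and p: "p \<notin> Domain r" and q: "q \<notin> Range r"
  shows "nontrivial_cycles (insert (p, q) r) = nontrivial_cycles r \<union>
    (if p \<noteq> q \<and> (q, p) \<in> r\<^sup>* then {(insert (p, q) r)\<^sup>+ `` {q}} else {})"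
    (is "nontrivial_cycles ?r = _ \<union> ?N")
    and "(insert (p, q) r)\<^sup>+ `` {q} \<in> nontrivial_cycles r \<Longrightarrow> (q, p) \<notin> r\<^sup>*"
proof -
  have np: "(x, p) \<notin> r\<^sup>*" if "(x, x) \<in> r\<^sup>+" for x
    using cyclic_reaches_cyclic[OF sv _ that] p by (blast dest: tranclD)
  have ins: "(x, y) \<in> ?r\<^sup>+ \<longleftrightarrow> (x, y) \<in> r\<^sup>+ \<or> (x, p) \<in> r\<^sup>* \<and> (q, y) \<in> r\<^sup>*" for x y
    by (simp add: trancl_insert)
  have old: "?r\<^sup>+ `` {x} = r\<^sup>+ `` {x}" "x \<noteq> p" if "(x, x) \<in> r\<^sup>+" for x
    using np[OF that] by (auto simp: ins)
  have pq: "(p, p) \<notin> r\<^sup>+" "(q, q) \<notin> r\<^sup>+"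
    using p q by (auto dest: tranclD tranclD2)
  show "nontrivial_cycles ?r = nontrivial_cycles r \<union> ?N"
  proof (intro equalityI subsetI)
    fix C assume "C \<in> nontrivial_cycles ?r"
    then obtain x where C: "C = ?r\<^sup>+ `` {x}" and x: "(x, x) \<in> ?r\<^sup>+" "(x, x) \<notin> ?r"
      unfolding nontrivial_cycles_def by auto
    show "C \<in> nontrivial_cycles r \<union> ?N"
    proof (cases "(x, x) \<in> r\<^sup>+")
      case True
      then show ?thesis
        using C x old unfolding nontrivial_cycles_def by auto
    next
      case False
      then have xp: "(x, p) \<in> r\<^sup>*" and qx: "(q, x) \<in> r\<^sup>*" using x ins by auto
      then have qp: "(q, p) \<in> r\<^sup>*" by auto
      have "p \<noteq> q"
      proof
        assume "p = q"
        \<comment> \<open>Without a predecessor, \<open>q = p\<close> can be reached only from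
          itself, so the cycle through \<open>x\<close> is the excluded loop.\<close>
        with xp q have "x = p" by (auto dest: rtranclD tranclD2)
        with x(2) \<open>p = q\<close> show False by auto
      qed
      \<comment> \<open>\<open>x\<close> and \<open>q\<close> reach each other through the new link,
        hence they have the same reachable set.\<close>
      moreover have "C = ?r\<^sup>+ `` {q}"
      proof -
        have "?r\<^sup>+ `` {u} \<subseteq> ?r\<^sup>+ `` {v}" if "(v, u) \<in> ?r\<^sup>+" for u v
          using that by auto
        moreover have "(x, q) \<in> ?r\<^sup>+" "(q, q) \<in> ?r\<^sup>+" "(q, x) \<in> ?r\<^sup>+"
          using xp qx qp by (auto simp: ins)
        ultimately show ?thesis unfolding C by blast
      qed
      ultimately show ?thesis using qp by simp
    qed
  next
    fix C assume "C \<in> nontrivial_cycles r \<union> ?N"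
    then show "C \<in> nontrivial_cycles ?r"
    proof
      assume "C \<in> nontrivial_cycles r"
      then obtain x where C: "C = r\<^sup>+ `` {x}" and x: "(x, x) \<in> r\<^sup>+" "(x, x) \<notin> r"
        unfolding nontrivial_cycles_def by auto
      then have "C = ?r\<^sup>+ `` {x}" "(x, x) \<in> ?r\<^sup>+" "(x, x) \<notin> ?r"
        using old[OF x(1)] by (auto simp: ins)
      then show ?thesis unfolding nontrivial_cycles_def by auto
    next
      assume "C \<in> ?N"
      then have "p \<noteq> q" "(q, p) \<in> r\<^sup>*" and C: "C = ?r\<^sup>+ `` {q}"
        by (auto split: if_splits)
      then have "(q, q) \<in> ?r\<^sup>+" "(q, q) \<notin> ?r"
        using q by (auto simp: ins)
      then show ?thesis unfolding nontrivial_cycles_def C by auto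
    qed
  qed
  show "(q, p) \<notin> r\<^sup>*" if "?r\<^sup>+ `` {q} \<in> nontrivial_cycles r"
  proof
    assume qp: "(q, p) \<in> r\<^sup>*"
    from that obtain x where x: "?r\<^sup>+ `` {q} = r\<^sup>+ `` {x}" "(x, x) \<in> r\<^sup>+"
      unfolding nontrivial_cycles_def by auto
    moreover have "(q, q) \<in> ?r\<^sup>+" using qp by (auto simp: ins)
    ultimately have "(x, q) \<in> r\<^sup>+" by auto
    with q show False by (auto dest: tranclD2)
  qed
qed

lemma card_nontrivial_cycles_insert:
  assumes "finite r" "single_valued r" "p \<notin> Domain r" "q \<notin> Range r"
  shows "card (nontrivial_cycles (insert (p, q) r)) =
    card (nontrivial_cycles r) + of_bool (p \<noteq> q \<and> (q, p) \<in> r\<^sup>*)"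
  using nontrivial_cycles_insert[OF assms(2-4)] finite_nontrivial_cycles[OF assms(1)]
  by (cases "p \<noteq> q \<and> (q, p) \<in> r\<^sup>*") (auto simp: card_insert_if)

text \<open>If everything reachable from \<open>b\<close> had a successor, the successor map would
  be an injective self-map of a finite set, hence onto, and \<open>b\<close> would have a
  predecessor. Two ends reachable from \<open>b\<close> agree by confluence.\<close>

lemma path_end_unique:
  assumes fin: "finite A" and r: "r \<in> pinj A A" and b: "b \<in> A - Range r"
  shows "\<exists>e\<in>A - Domain r. \<forall>a\<in>A - Domain r. (b, a) \<in> r\<^sup>* \<longleftrightarrow> a = e"
proof -
  have sub: "r \<subseteq> A \<times> A" and sv: "single_valued r" "single_valued (r\<inverse>)"
    using r unfolding pinj_def by auto
  let ?R = "r\<^sup>* `` {b}"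
  have RA: "?R \<subseteq> A"
    using b sub by (auto elim: rtrancl.cases)
  have "\<exists>e\<in>?R. e \<notin> Domain r"
  proof (rule ccontr)
    assume "\<not> ?thesis"
    then have "\<forall>x\<in>?R. \<exists>y. (x, y) \<in> r" by auto
    then obtain f where f: "\<And>x. x \<in> ?R \<Longrightarrow> (x, f x) \<in> r" by metis
    have "inj_on f ?R"
      using f sv(2) unfolding inj_on_def single_valued_def by (metis converse_iff)
    moreover have "f ` ?R \<subseteq> ?R"
      using f by (auto intro: rtrancl_into_rtrancl)
    ultimately have "f ` ?R = ?R"
      using RA fin by (meson endo_inj_surj finite_subset)
    then have "b \<in> f ` ?R" by auto
    then show False using f b by auto
  qed
  then obtain e where e: "(b, e) \<in> r\<^sup>*" "e \<notin> Domain r" by auto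
  have "a = e" if "a \<notin> Domain r" "(b, a) \<in> r\<^sup>*" for a
    using single_valued_confluent[OF sv(1) e(1) that(2)] e(2) that(1)
    by (auto dest: Not_Domain_rtrancl)
  then show ?thesis using e RA by auto
qed

text \<open>
  \<open>A\<close> is the set of the elements preceding \<open>z\<close> in the order of insertion. In \<open>min_peaks\<close> the lists
  run from the last inserted element to the first.
\<close>

definition min_peak :: "'a::linorder \<Rightarrow> 'a set \<Rightarrow> 'a rel \<Rightarrow> bool" where
  "min_peak z A r \<longleftrightarrow> (\<exists>u\<in>A. \<exists>v\<in>A. (u, z) \<in> r \<and> (z, v) \<in> r \<and>
     (\<forall>w\<in>A. w < v \<longrightarrow> w \<in> r `` A))"

fun min_peaks :: "'a::linorder list \<Rightarrow> 'a rel \<Rightarrow> nat" where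
  "min_peaks [] r = 0"
| "min_peaks (z # zs) r = min_peaks zs r + of_bool (min_peak z (set zs) r)"

text \<open>Each test reads only links inside \<open>insert z (set zs)\<close>; links to elements
  inserted later therefore leave the count unchanged.\<close>

lemma min_peaks_insert:
  "a \<notin> set zs \<or> b \<notin> set zs \<Longrightarrow> min_peaks zs (insert (a, b) r) = min_peaks zs r"
proof (induction zs)
  case (Cons z zs)
  then have m: "(u, v) \<in> insert (a, b) r \<longleftrightarrow> (u, v) \<in> r"
    if "u \<in> insert z (set zs)" "v \<in> insert z (set zs)" for u v
    using that by auto
  then have "w \<in> insert (a, b) r `` set zs \<longleftrightarrow> w \<in> r `` set zs" if "w \<in> set zs" for w
    using that by blast
  with m have "min_peak z (set zs) (insert (a, b) r) = min_peak z (set zs) r"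
    unfolding min_peak_def by (intro bex_cong conj_cong ball_cong imp_cong refl) auto
  with Cons show ?case by auto
qed auto

text \<open>
  The weight of the Motzkin paths of \<open>m\<close> steps from height \<open>0\<close> to height \<open>k\<close>.
\<close>

fun jfrac :: "'a::comm_semiring_1 \<Rightarrow> 'a \<Rightarrow> nat \<Rightarrow> nat \<Rightarrow> 'a" where
  "jfrac x y 0 k = of_bool (k = 0)"
| "jfrac x y (Suc m) k = (if k = 0 then 0 else jfrac x y m (k - 1))
     + of_nat (2 * k + 1) * jfrac x y m k
     + (of_nat k + x) * (of_nat k + y) * jfrac x y m (Suc k)"

section \<open>Joint count of minimal peaks and cycles by the continued fraction\<close>

lemma jfrac_commute: "jfrac x y m k = jfrac y x m k"
  by (induction m arbitrary: k) (simp_all add: mult_ac)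

text \<open>Source of the factors \<open>of_nat k + x\<close> and \<open>of_nat k + y\<close>: one
  of \<open>k + 1\<close> choices is marked.\<close>

lemma sum_distinguished:
  fixes y :: "'a::comm_semiring_1"
  assumes "finite S" "e \<in> S"
  shows "(\<Sum>a\<in>S. y ^ of_bool (a = e)) = of_nat (card S - 1) + y"
proof -
  have "(\<Sum>a\<in>S. y ^ of_bool (a = e)) = y + (\<Sum>a\<in>S - {e}. y ^ of_bool (a = e))"
    using assms by (subst sum.remove[of _ e]) auto
  also have "(\<Sum>a\<in>S - {e}. y ^ of_bool (a = e)) = (\<Sum>a\<in>S - {e}. 1)"
    by (intro sum.cong) auto
  finally show ?thesis using assms by (simp add: add.commute)
qed

text \<open>Here \<open>k\<close> is the number of open paths. An isolated \<open>z\<close> opens a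
  path; a loop or an extension at either end of a path keeps \<open>k\<close>, in
  \<open>2 * k + 1\<close> ways; a link on both sides lowers \<open>k + 1\<close> to
  \<open>k\<close>, and its choices of \<open>b\<close> and \<open>a\<close> contribute
  \<open>(of_nat k + x) * (of_nat k + y)\<close>.\<close>

lemma sum_min_peaks_cycles:
  fixes x y :: "'a::comm_semiring_1" and zs :: "'b::linorder list"
  assumes "distinct zs"
  shows "(\<Sum>r\<in>pinj (set zs) (set zs). of_bool (card r + k = length zs) *
     (x ^ min_peaks zs r * y ^ card (nontrivial_cycles r))) = jfrac x y (length zs) k"
  using assms
proof (induction zs arbitrary: k)
  case Nil
  have "pinj {} {} = {{} :: 'b rel}" unfolding pinj_def by auto
  then show ?case by (simp add: nontrivial_cycles_def)
next
  case (Cons z zs)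
  define A where "A = set zs"
  have fin: "finite A" and z: "z \<notin> A" and cA: "card A = length zs"
    using Cons.prems by (auto simp: A_def distinct_card)
  define W where "W r = x ^ min_peaks zs r * y ^ card (nontrivial_cycles r)" for r
  define w where "w r = of_bool (card r + k = length (z # zs)) *
     (x ^ min_peaks (z # zs) r * y ^ card (nontrivial_cycles r))" for r
  note IH = Cons.IH[folded A_def]
  have *: "w r + w (insert (z, z) r) + (\<Sum>a\<in>A - Domain r. w (insert (a, z) r))
     + (\<Sum>b\<in>A - Range r. w (insert (z, b) r))
     + (\<Sum>a\<in>A - Domain r. \<Sum>b\<in>A - Range r. w (insert (z, b) (insert (a, z) r)))
    = of_bool (k \<noteq> 0) * (of_bool (card r + (k - 1) = length zs) * W r)
     + of_nat (2 * k + 1) * (of_bool (card r + k = length zs) * W r)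
     + (of_nat k + x) * (of_nat k + y) * (of_bool (card r + Suc k = length zs) * W r)"
    if r: "r \<in> pinj A A" for r
  proof -
    have sub: "r \<subseteq> A \<times> A" and sv: "single_valued r" "single_valued (r\<inverse>)"
      using r unfolding pinj_def by auto
    have finr: "finite r" using pinj_finite fin r by blast
    have zr: "z \<notin> Domain r" "z \<notin> Range r" using sub z by auto
    have znr [simp]: "(z, b) \<notin> r" "(a, z) \<notin> r" for a b using zr by auto
    have rtz: "(b, z) \<notin> r\<^sup>*" "(z, b) \<notin> r\<^sup>*" if "b \<in> A" for b
      using zr that z by (auto elim: rtranclE converse_rtranclE)
    note mp = min_peaks_insert[of _ zs, folded A_def]
    \<comment> \<open>For \<open>k = 0\<close> the left side vanishes because
      \<open>card r \<le> card A\<close>; the factor \<open>of_bool (k \<noteq> 0)\<close> guards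
      the truncated \<open>k - 1\<close>.\<close>
    have w0: "w r = of_bool (k \<noteq> 0) * (of_bool (card r + (k - 1) = length zs) * W r)"
      using pinj_card_Diff(3)[OF fin r] cA by (cases k) (auto simp: w_def W_def min_peak_def)
    have w1: "w (insert (z, z) r) = of_bool (card r + k = length zs) * W r"
      using z zr finr by (simp add: w_def W_def min_peak_def mp card_nontrivial_cycles_insert sv
          flip: A_def)
    have w2: "w (insert (a, z) r) = of_bool (card r + k = length zs) * W r" if "a \<in> A - Domain r" for a
    proof -
      have "\<not> min_peak z A (insert (a, z) r)"
        using z that unfolding min_peak_def by auto
      moreover have "card (nontrivial_cycles (insert (a, z) r)) = card (nontrivial_cycles r)"
        using that zr rtz by (subst card_nontrivial_cycles_insert) (auto simp: finr sv)
      ultimately show ?thesis using z finr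
        by (simp add: w_def W_def mp flip: A_def)
    qed
    have w3: "w (insert (z, b) r) = of_bool (card r + k = length zs) * W r" if "b \<in> A - Range r" for b
    proof -
      have "\<not> min_peak z A (insert (z, b) r)"
        using z that unfolding min_peak_def by auto
      moreover have "card (nontrivial_cycles (insert (z, b) r)) = card (nontrivial_cycles r)"
        using that zr rtz by (subst card_nontrivial_cycles_insert) (auto simp: finr sv)
      ultimately show ?thesis using z finr
        by (simp add: w_def W_def mp flip: A_def)
    qed
    \<comment> \<open>A path from \<open>b\<close> to \<open>a\<close> is closed into a cycle,
      marked by \<open>y\<close>; the least available initial point \<open>b\<close> makes
      \<open>z\<close> a minimal peak, marked by \<open>x\<close>.\<close>
    have w4: "w (insert (z, b) (insert (a, z) r)) = of_bool (card r + Suc k = length zs) * W r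
        * (x ^ of_bool (b = Min (A - Range r)) * y ^ of_bool ((b, a) \<in> r\<^sup>*))"
      if a: "a \<in> A - Domain r" and b: "b \<in> A - Range r" for a b
    proof -
      let ?r = "insert (a, z) r"
      have az: "a \<noteq> z" "b \<noteq> z" using a b z by auto
      have sv1: "single_valued ?r" using sv(1) a by (auto simp: single_valued_def)
      have "card (nontrivial_cycles ?r) = card (nontrivial_cycles r)"
        using a zr rtz by (subst card_nontrivial_cycles_insert) (auto simp: finr sv)
      moreover have "card (nontrivial_cycles (insert (z, b) ?r)) =
          card (nontrivial_cycles ?r) + of_bool (z \<noteq> b \<and> (b, z) \<in> ?r\<^sup>*)"
        by (rule card_nontrivial_cycles_insert) (use finr sv1 a b zr az in auto)
      moreover have "(b, z) \<in> ?r\<^sup>* \<longleftrightarrow> (b, a) \<in> r\<^sup>*"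
        using rtz b by (auto simp: rtrancl_insert)
      ultimately have c: "card (nontrivial_cycles (insert (z, b) ?r)) =
          card (nontrivial_cycles r) + of_bool ((b, a) \<in> r\<^sup>*)"
        using az by auto
      have "w \<in> insert (z, b) ?r `` A \<longleftrightarrow> w \<in> Range r" if "w \<in> A" for w
        using that sub z by auto
      moreover have "(u, z) \<in> insert (z, b) ?r \<longleftrightarrow> u = a" for u
        using az by auto
      moreover have "(z, v) \<in> insert (z, b) ?r \<longleftrightarrow> v = b" for v
        using az by auto
      ultimately have "min_peak z A (insert (z, b) ?r) \<longleftrightarrow> (\<forall>w\<in>A. w < b \<longrightarrow> w \<in> Range r)"
        using a b unfolding min_peak_def by simp
      also have "\<dots> \<longleftrightarrow> (\<forall>w\<in>A - Range r. b \<le> w)"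
        by (meson DiffE DiffI leD leI)
      also have "\<dots> \<longleftrightarrow> b = Min (A - Range r)"
        using b fin by (metis Min_eqI Min_le finite_Diff)
      finally have m: "min_peak z A (insert (z, b) ?r) \<longleftrightarrow> b = Min (A - Range r)" .
      have "card (insert (z, b) ?r) = Suc (Suc (card r))"
        using finr az by auto
      then show ?thesis
        using z by (simp add: w_def W_def mp c m power_add mult_ac flip: A_def)
    qed
    let ?D = "A - Domain r" and ?R = "A - Range r"
    have cD: "card ?D = length zs - card r" and cR: "card ?R = length zs - card r"
      using pinj_card_Diff[OF fin r] cA by auto
    have k: "length zs - card r = k" if "card r + k = length zs" using that by simp
    have s2: "(\<Sum>a\<in>?D. w (insert (a, z) r)) = of_nat k * (of_bool (card r + k = length zs) * W r)"
      using w2 cD k by auto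
    have s3: "(\<Sum>b\<in>?R. w (insert (z, b) r)) = of_nat k * (of_bool (card r + k = length zs) * W r)"
      using w3 cR k by auto
    have s4: "(\<Sum>a\<in>?D. \<Sum>b\<in>?R. w (insert (z, b) (insert (a, z) r))) =
      (of_nat k + x) * (of_nat k + y) * (of_bool (card r + Suc k = length zs) * W r)"
    proof (cases "card r + Suc k = length zs")
      case True
      then have ck: "card ?D = Suc k" "card ?R = Suc k" using cD cR by auto
      then have neR: "?R \<noteq> {}" by (metis card.empty nat.distinct(1))
      \<comment> \<open>For each \<open>b\<close> exactly one terminal point closes a cycle. The sum
        over \<open>a\<close> is thus the same for all \<open>b\<close>, which lets the double sum
        factor.\<close>
      have e: "(\<Sum>a\<in>?D. y ^ of_bool ((b, a) \<in> r\<^sup>*)) = of_nat k + y" if b: "b \<in> ?R" for b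
      proof -
        obtain e where e: "e \<in> ?D" "\<forall>a\<in>?D. (b, a) \<in> r\<^sup>* \<longleftrightarrow> a = e"
          using path_end_unique[OF fin r b] by auto
        then have "(\<Sum>a\<in>?D. y ^ of_bool ((b, a) \<in> r\<^sup>*)) = (\<Sum>a\<in>?D. y ^ of_bool (a = e))"
          by (intro sum.cong) auto
        then show ?thesis using sum_distinguished[of ?D e y] e(1) fin ck by auto
      qed
      have "(\<Sum>a\<in>?D. \<Sum>b\<in>?R. w (insert (z, b) (insert (a, z) r))) =
        (\<Sum>a\<in>?D. \<Sum>b\<in>?R. W r * (x ^ of_bool (b = Min ?R) * y ^ of_bool ((b, a) \<in> r\<^sup>*)))"
        using w4 True by (intro sum.cong) auto
      also have "\<dots> = (\<Sum>b\<in>?R. W r * (x ^ of_bool (b = Min ?R) *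
          (\<Sum>a\<in>?D. y ^ of_bool ((b, a) \<in> r\<^sup>*))))"
        by (subst sum.swap) (simp add: sum_distrib_left)
      also have "\<dots> = (\<Sum>b\<in>?R. W r * (of_nat k + y) * x ^ of_bool (b = Min ?R))"
        using e by (intro sum.cong) (auto simp: mult_ac)
      also have "\<dots> = W r * (of_nat k + y) * (of_nat k + x)"
        using sum_distinguished[of ?R "Min ?R" x] Min_in[OF _ neR] fin ck
        by (simp flip: sum_distrib_left)
      finally show ?thesis using True by (simp add: mult_ac)
    next
      case False
      then have "(\<Sum>a\<in>?D. \<Sum>b\<in>?R. w (insert (z, b) (insert (a, z) r))) = 0"
        using w4 by (intro sum.neutral ballI) auto
      with False show ?thesis by simp
    qed
    have "of_nat (2 * k + 1) = 1 + of_nat k + (of_nat k :: 'a)" by (simp add: mult_2 add.assoc)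
    then show ?thesis unfolding s2 s3 s4 w0 w1 by (simp only: ring_distribs) (simp add: ac_simps)
  qed
  have "(\<Sum>r\<in>pinj (set (z # zs)) (set (z # zs)). w r) = (\<Sum>r\<in>pinj A A.
     of_bool (k \<noteq> 0) * (of_bool (card r + (k - 1) = length zs) * W r)
     + of_nat (2 * k + 1) * (of_bool (card r + k = length zs) * W r)
     + (of_nat k + x) * (of_nat k + y) * (of_bool (card r + Suc k = length zs) * W r))"
    using sum_pinj_insert[OF fin z, of w] * by (simp add: A_def)
  also have "\<dots> = jfrac x y (length (z # zs)) k"
    using IH[of "k - 1"] IH[of k] IH[of "Suc k"] Cons.prems
    unfolding sum.distrib sum_distrib_left[symmetric] W_def[symmetric] by simp
  finally show ?case unfolding w_def .
qed

section \<open>Partial words\<close>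

text \<open>The increasing enumeration of the numbers other than \<open>c\<close>: it frees the
  value \<open>c\<close> and keeps relative order.\<close>

definition skip :: "nat \<Rightarrow> nat \<Rightarrow> nat" where
  "skip c v = (if v < c then v else Suc v)"

lemma strict_mono_skip: "strict_mono (skip c)"
  by (auto simp: strict_mono_def skip_def)

lemma inj_skip: "inj (skip c)"
  by (rule strict_mono_imp_inj_on[OF strict_mono_skip])

lemma skip_less_iff [simp]: "skip c u < skip c v \<longleftrightarrow> u < v"
  by (auto simp: skip_def)

lemma skip_eq [simp]: "v < c \<Longrightarrow> skip c v = v"
  by (simp add: skip_def)

lemma range_skip: "range (skip c) = - {c}"
proof -
  have "v \<in> range (skip c)" if "v \<noteq> c" for v
  proof (cases "v < c")
    case True
    then show ?thesis by (metis rangeI skip_eq)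
  next
    case False
    with that have "v = skip c (v - 1)" by (auto simp: skip_def)
    then show ?thesis by blast
  qed
  then show ?thesis by (auto simp: skip_def split: if_splits)
qed

lemma map_skip_exhaust:
  assumes "c \<notin> set ys"
  obtains zs where "ys = map (skip c) zs"
proof -
  have "set ys \<subseteq> range (skip c)" using assms by (auto simp: range_skip)
  then have "ys \<in> range (map (skip c))" by (metis lists_UNIV lists_image in_listsI subsetD)
  then show ?thesis using that by auto
qed

text \<open>
  The reversed list of the values taken at positions \<open>1, \<dots>, p\<close>, when only the values up to \<open>q\<close>
  are known: the \<open>k\<close> larger values are known up to their relative order only, and are represented
  by \<open>q + 1, \<dots>, q + k\<close>.
\<close>

definition partial_words :: "nat \<Rightarrow> nat \<Rightarrow> nat \<Rightarrow> nat list set" where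
  "partial_words p q k =
     {ys. length ys = p \<and> distinct ys \<and> set ys \<subseteq> {1..q + k} \<and> {q<..q + k} \<subseteq> set ys}"

lemma finite_partial_words: "finite (partial_words p q k)"
  unfolding partial_words_def
  by (rule finite_subset[OF _ finite_lists_length_eq[of "{1..q + k}" p]]) auto

text \<open>All values above \<open>q\<close> that are allowed do occur, so every missing value is a
  known one.\<close>

lemma card_missing_values:
  assumes "ys \<in> partial_words p q k"
  shows "card ({1..q} - set ys) = q + k - p"
proof -
  have ys: "length ys = p" "distinct ys" "set ys \<subseteq> {1..q + k}" "{q<..q + k} \<subseteq> set ys"
    using assms unfolding partial_words_def by auto
  have "v \<le> q" if "v \<notin> set ys" "v \<le> q + k" for v
    using ys(4) that by (meson greaterThanAtMost_iff not_le subsetD)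
  then have "{1..q} - set ys = {1..q + k} - set ys" by auto
  then show ?thesis
    using ys by (simp add: card_Diff_subset distinct_card)
qed

text \<open>This is the case where the newly known value \<open>Suc q\<close> has not been taken:
  all \<open>k\<close> larger values move up by one.\<close>

lemma map_skip_partial_words:
  "map (skip (Suc q)) zs \<in> partial_words p (Suc q) k \<longleftrightarrow> zs \<in> partial_words p q k"
proof -
  have "skip (Suc q) v \<in> {1..Suc q + k} \<longleftrightarrow> v \<in> {1..q + k}" for v
    by (auto simp: skip_def)
  then have 1: "skip (Suc q) ` set zs \<subseteq> {1..Suc q + k} \<longleftrightarrow> set zs \<subseteq> {1..q + k}"
    unfolding image_subset_iff by blast
  have "skip (Suc q) ` {q<..q + k} = Suc ` {q<..q + k}"
    by (rule image_cong) (auto simp: skip_def)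
  then have "{Suc q<..Suc q + k} = skip (Suc q) ` {q<..q + k}"
    by (simp add: image_Suc_atLeastAtMost flip: atLeastSucAtMost_greaterThanAtMost)
  then have 2: "{Suc q<..Suc q + k} \<subseteq> skip (Suc q) ` set zs \<longleftrightarrow> {q<..q + k} \<subseteq> set zs"
    by (simp only: inj_image_subset_iff[OF inj_skip])
  show ?thesis
    unfolding partial_words_def mem_Collect_eq length_map set_map distinct_map 1 2
    using inj_on_subset[OF inj_skip] by blast
qed

text \<open>This is the case where \<open>Suc q\<close> has been taken: it is the least of the
  \<open>Suc k\<close> large values, and the word itself does not change.\<close>

lemma partial_words_Suc_value:
  "partial_words p q (Suc k) = {ys \<in> partial_words p (Suc q) k. Suc q \<in> set ys}"
proof -
  have "{q<..q + Suc k} = insert (Suc q) {Suc q<..Suc q + k}" by auto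
  then show ?thesis unfolding partial_words_def by auto
qed

lemma sum_partial_words_value:
  fixes w :: "nat list \<Rightarrow> 'c::comm_monoid_add"
  shows "(\<Sum>ys\<in>partial_words p (Suc q) k. w ys) =
    (\<Sum>zs\<in>partial_words p q k. w (map (skip (Suc q)) zs)) + (\<Sum>ys\<in>partial_words p q (Suc k). w ys)"
proof -
  let ?N = "{ys \<in> partial_words p (Suc q) k. Suc q \<notin> set ys}"
  have "?N = map (skip (Suc q)) ` partial_words p q k"
  proof (intro equalityI subsetI)
    fix ys assume ys: "ys \<in> ?N"
    then obtain zs where "ys = map (skip (Suc q)) zs" by (blast elim: map_skip_exhaust)
    with ys show "ys \<in> map (skip (Suc q)) ` partial_words p q k"
      by (auto simp: map_skip_partial_words)
  qed (auto simp: map_skip_partial_words skip_def split: if_splits)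
  then have "(\<Sum>ys\<in>?N. w ys) = (\<Sum>zs\<in>partial_words p q k. w (map (skip (Suc q)) zs))"
    by (simp add: sum.reindex inj_on_subset[OF inj_mapI[OF inj_skip]])
  moreover have "partial_words p (Suc q) k = ?N \<union> partial_words p q (Suc k)"
    unfolding partial_words_Suc_value by auto
  moreover have "?N \<inter> partial_words p q (Suc k) = {}"
    unfolding partial_words_Suc_value by auto
  ultimately show ?thesis
    by (metis (no_types, lifting) finite_Un finite_partial_words sum.union_disjoint)
qed

text \<open>The new large value has rank \<open>c - q\<close> among the \<open>Suc k\<close> large
  values; those from \<open>c\<close> on shift to make room.\<close>

lemma Cons_skip_partial_words:
  assumes c: "c \<in> {q<..q + Suc k}"
  shows "c # map (skip c) zs \<in> partial_words (Suc p) q (Suc k) \<longleftrightarrow> zs \<in> partial_words p q k"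
proof -
  have "skip c v \<in> {1..q + Suc k} \<longleftrightarrow> v \<in> {1..q + k}" for v
    using c by (auto simp: skip_def)
  then have 1: "skip c ` set zs \<subseteq> {1..q + Suc k} \<longleftrightarrow> set zs \<subseteq> {1..q + k}"
    unfolding image_subset_iff by blast
  have "v \<in> skip c ` {q<..q + k}" if v: "v \<in> {q<..q + Suc k}" "v \<noteq> c" for v
  proof -
    obtain u where "v = skip c u" using v(2) range_skip[of c] by auto
    with v(1) c show ?thesis by (auto simp: skip_def split: if_splits)
  qed
  moreover have "skip c v \<in> {q<..q + Suc k}" if "v \<in> {q<..q + k}" for v
    using that by (auto simp: skip_def)
  ultimately have "{q<..q + Suc k} = insert c (skip c ` {q<..q + k})"
    using c by blast
  moreover have nc: "c \<notin> skip c ` Z" for Z using range_skip[of c] by auto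
  ultimately have 2: "{q<..q + Suc k} \<subseteq> insert c (skip c ` set zs) \<longleftrightarrow> {q<..q + k} \<subseteq> set zs"
    by (simp add: subset_insert inj_image_subset_iff[OF inj_skip])
  have "c \<in> {1..q + Suc k}" using c by auto
  then show ?thesis
    unfolding partial_words_def mem_Collect_eq list.size set_map length_map distinct.simps
      distinct_map list.set insert_subset 1 2
    using inj_on_subset[OF inj_skip] nc by auto
qed

text \<open>The new position takes either a missing known value, which keeps \<open>k\<close>, or a
  large value of arbitrary rank, which raises \<open>k - 1\<close> to \<open>k\<close>.\<close>

lemma sum_partial_words_position:
  fixes w :: "nat list \<Rightarrow> 'c::comm_monoid_add"
  shows "(\<Sum>ys\<in>partial_words (Suc p) q k. w ys) =
    (\<Sum>us\<in>partial_words p q k. \<Sum>c\<in>{1..q} - set us. w (c # us)) +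
    (if k = 0 then 0
     else \<Sum>us\<in>partial_words p q (k - 1). \<Sum>c\<in>{q<..q + k}. w (c # map (skip c) us))"
proof -
  let ?S = "{ys \<in> partial_words (Suc p) q k. hd ys \<le> q}"
  let ?L = "{ys \<in> partial_words (Suc p) q k. hd ys > q}"
  have S: "(\<Sum>ys\<in>?S. w ys) = (\<Sum>us\<in>partial_words p q k. \<Sum>c\<in>{1..q} - set us. w (c # us))"
  proof -
    have "(\<Sum>ys\<in>?S. w ys) =
        (\<Sum>(us, c)\<in>Sigma (partial_words p q k) (\<lambda>us. {1..q} - set us). w (c # us))"
      by (rule sum.reindex_bij_witness[where j = "\<lambda>ys. (tl ys, hd ys)" and i = "\<lambda>(us, c). c # us"])
        (auto simp: partial_words_def length_Suc_conv subset_insert)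
    then show ?thesis by (subst sum.Sigma) (auto simp: finite_partial_words)
  qed
  have L: "(\<Sum>ys\<in>?L. w ys) = (if k = 0 then 0
     else \<Sum>us\<in>partial_words p q (k - 1). \<Sum>c\<in>{q<..q + k}. w (c # map (skip c) us))"
  proof (cases k)
    case 0
    then have empty: "?L = {}" by (auto simp: partial_words_def length_Suc_conv)
    show ?thesis unfolding empty using 0 by simp
  next
    case (Suc j)
    let ?g = "\<lambda>(us, c). c # map (skip c) us"
    have "?L = ?g ` (partial_words p q j \<times> {q<..q + k})"
    proof (intro equalityI subsetI)
      fix ys assume ys: "ys \<in> ?L"
      then obtain c vs where cvs: "ys = c # vs" "c \<in> {q<..q + k}" "c \<notin> set vs"
        by (auto simp: partial_words_def length_Suc_conv)
      then obtain us where "vs = map (skip c) us" by (blast elim: map_skip_exhaust)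
      with ys cvs Suc Cons_skip_partial_words[of c q j us p]
      show "ys \<in> ?g ` (partial_words p q j \<times> {q<..q + k})" by force
    qed (use Suc Cons_skip_partial_words in auto)
    moreover have "inj_on ?g (partial_words p q j \<times> {q<..q + k})"
      by (auto simp: inj_on_def inj_map_eq_map[OF inj_skip])
    ultimately have "(\<Sum>ys\<in>?L. w ys) =
        (\<Sum>(us, c)\<in>partial_words p q j \<times> {q<..q + k}. w (c # map (skip c) us))"
      by (simp add: sum.reindex case_prod_unfold)
    then show ?thesis using Suc by (simp add: sum.cartesian_product)
  qed
  have "partial_words (Suc p) q k = ?S \<union> ?L" "?S \<inter> ?L = {}" by auto
  then have "(\<Sum>ys\<in>partial_words (Suc p) q k. w ys) = (\<Sum>ys\<in>?S. w ys) + (\<Sum>ys\<in>?L. w ys)"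
    by (metis (no_types, lifting) finite_Un finite_partial_words sum.union_disjoint)
  then show ?thesis unfolding S L .
qed

section \<open>Pure excedances and exclusive antirecord cycle peaks of partial words\<close>

fun word_pex :: "nat list \<Rightarrow> nat" where
  "word_pex [] = 0"
| "word_pex (c # ys) = word_pex ys +
     of_bool (Suc (length ys) < c \<and> set ys \<inter> {Suc (length ys)..c} = {})"

text \<open>The head \<open>c\<close> sits at position \<open>i = Suc (length ys)\<close>. That
  \<open>i\<close> is an earlier value together with \<open>c < i\<close> expresses a cycle peak;
  that all values below \<open>c\<close> are earlier expresses an antirecord.\<close>

fun word_ear :: "nat list \<Rightarrow> nat" where
  "word_ear [] = 0"
| "word_ear (c # ys) = word_ear ys +
     of_bool (c < Suc (length ys) \<and> Suc (length ys) \<in> set ys \<and> {1..<c} \<subseteq> set ys)"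

text \<open>All position numbers lie below \<open>c\<close> and are fixed by the increasing map
  \<open>skip c\<close>, so comparisons of values with positions and with each other are
  preserved.\<close>

lemma word_pex_skip: "length ys < c \<Longrightarrow> word_pex (map (skip c) ys) = word_pex ys"
proof (induction ys)
  case (Cons v ys)
  define M where "M = Suc (length ys)"
  have M: "skip c M = M" using Cons.prems by (simp add: M_def)
  have "M < skip c v \<longleftrightarrow> M < v" "\<And>u. u \<in> {M..v} \<longleftrightarrow> skip c u \<in> {M..skip c v}"
    using skip_less_iff[of c M v] skip_less_iff[of c _ M] skip_less_iff[of c v] M
    by (auto simp flip: not_less)
  then have "M < skip c v \<and> skip c ` set ys \<inter> {M..skip c v} = {} \<longleftrightarrow> M < v \<and> set ys \<inter> {M..v} = {}"
    by blast
  then show ?case using Cons by (simp add: M_def)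
qed simp

text \<open>The statistic only asks about values up to the current position, which
  \<open>skip c\<close> fixes.\<close>

lemma word_ear_skip: "length ys < c \<Longrightarrow> word_ear (map (skip c) ys) = word_ear ys"
proof (induction ys)
  case (Cons v ys)
  define M where "M = Suc (length ys)"
  have M: "skip c M = M" using Cons.prems by (simp add: M_def)
  have mem: "u \<in> skip c ` Z \<longleftrightarrow> u \<in> Z" if "u \<le> M" for u and Z
  proof -
    have "u = skip c u" using that Cons.prems by (simp add: M_def)
    then show ?thesis by (metis inj_image_mem_iff[OF inj_skip])
  qed
  have "skip c v < M \<longleftrightarrow> v < M" using skip_less_iff[of c v M] M by simp
  moreover have "{1..<skip c v} \<subseteq> skip c ` set ys \<longleftrightarrow> {1..<v} \<subseteq> set ys" if "v < M"
    using that mem Cons.prems by (auto simp: subset_iff M_def)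
  ultimately have "skip c v < M \<and> M \<in> skip c ` set ys \<and> {1..<skip c v} \<subseteq> skip c ` set ys \<longleftrightarrow>
      v < M \<and> M \<in> set ys \<and> {1..<v} \<subseteq> set ys"
    using mem[of M] by blast
  then show ?case using Cons by (simp add: M_def)
qed simp

text \<open>A step first decides whether the value \<open>M = Suc m\<close> was taken, then fills
  position \<open>M\<close>. The height \<open>k\<close> is kept with weight \<open>k + 1\<close>
  (\<open>M\<close> free, small value) or \<open>k\<close> (\<open>M\<close> taken, large value),
  reached from \<open>k - 1\<close> with weight \<open>k - 1 + x\<close>, and from
  \<open>k + 1\<close> with weight \<open>k + y\<close>. The product in front moves the factors with
  \<open>x\<close> from the rises to the falls.\<close>

lemma sum_partial_words_pex_ear:
  fixes x y :: "'a::comm_semiring_1"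
  shows "(\<Sum>ys\<in>partial_words m m k. x ^ word_pex ys * y ^ word_ear ys) =
    (\<Prod>j<k. of_nat j + x) * jfrac x y m k"
proof (induction m arbitrary: k)
  case 0
  have "partial_words 0 0 k = (if k = 0 then {[]} else {})"
    by (auto simp: partial_words_def)
  then show ?case by auto
next
  case (Suc m)
  define M where "M = Suc m"
  define W :: "nat list \<Rightarrow> 'a" where "W ys = x ^ word_pex ys * y ^ word_ear ys" for ys
  have W_skip: "W (map (skip c) ys) = W ys" if "length ys < c" for c ys
    using that by (simp add: W_def word_pex_skip word_ear_skip)
  \<comment> \<open>There are \<open>Suc k\<close> missing values; if \<open>M\<close> is taken, the
    least of them gives a cycle peak that is an antirecord. If \<open>M\<close> is free, no choice
    is marked.\<close>
  have small: "(\<Sum>c\<in>{1..M} - set us. W (c # us)) =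
      W us * (of_nat k + (if M \<in> set us then y else 1))" if us: "us \<in> partial_words m M k" for us
  proof -
    let ?D = "{1..M} - set us"
    have len: "Suc (length us) = M" and card: "card ?D = Suc k"
      using us card_missing_values[OF us] by (auto simp: partial_words_def M_def)
    then have ne: "?D \<noteq> {}" by (metis card.empty nat.distinct(1))
    have fin: "finite ?D" by simp
    have "W (c # us) = W us * (if M \<in> set us then y else 1) ^ of_bool (c = Min ?D)"
      if c: "c \<in> ?D" for c
    proof -
      have "{1..<c} \<subseteq> set us \<longleftrightarrow> (\<forall>w\<in>?D. c \<le> w)"
      proof
        show "\<forall>w\<in>?D. c \<le> w" if "{1..<c} \<subseteq> set us"
          using that by (metis Diff_iff atLeastAtMost_iff atLeastLessThan_iff leI subsetD)
        show "{1..<c} \<subseteq> set us" if least: "\<forall>w\<in>?D. c \<le> w"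
        proof (intro subsetI, rule ccontr)
          fix v assume v: "v \<in> {1..<c}" "v \<notin> set us"
          with c have "v \<in> ?D" by auto
          with least have "c \<le> v" by blast
          with v show False by simp
        qed
      qed
      also have "\<dots> \<longleftrightarrow> c = Min ?D"
        using c by (metis Min_eqI Min_le finite_Diff finite_atLeastAtMost)
      finally have "{1..<c} \<subseteq> set us \<longleftrightarrow> c = Min ?D" .
      moreover have "c < M" if "M \<in> set us"
        using c that by (cases "c = M") auto
      ultimately show ?thesis
        using c len by (auto simp: W_def mult_ac)
    qed
    then have "(\<Sum>c\<in>?D. W (c # us)) =
        W us * (\<Sum>c\<in>?D. (if M \<in> set us then y else 1) ^ of_bool (c = Min ?D))"
      unfolding sum_distrib_left by (intro sum.cong) auto
    also have "\<dots> = W us * (of_nat k + (if M \<in> set us then y else 1))"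
      by (simp only: sum_distinguished[OF fin Min_in[OF fin ne]] card diff_Suc_1)
    finally show ?thesis .
  qed
  \<comment> \<open>An excedance at \<open>M\<close> is pure only if \<open>M\<close> is free and
    the value is the least large one: otherwise \<open>Suc M\<close> is already taken and lies in
    the interval.\<close>
  have large: "(\<Sum>c\<in>{M<..M + k}. W (c # map (skip c) us)) =
      W us * (of_nat (k - 1) + (if M \<in> set us then 1 else x))"
    if us: "us \<in> partial_words m M (k - 1)" and k: "k \<noteq> 0" for us
  proof -
    have len: "Suc (length us) = M" and sub: "{M<..M + (k - 1)} \<subseteq> set us"
      using us by (auto simp: partial_words_def M_def)
    have "W (c # map (skip c) us) = W us * (if M \<in> set us then 1 else x) ^ of_bool (c = Suc M)"
      if c: "c \<in> {M<..M + k}" for c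
    proof -
      have mem: "u \<in> skip c ` set us \<longleftrightarrow> u \<in> set us" if "u < c" for u
        by (metis inj_image_mem_iff[OF inj_skip] skip_eq that)
      have "skip c ` set us \<inter> {M..c} = {} \<longleftrightarrow> M \<notin> set us \<and> c = Suc M"
      proof
        assume *: "skip c ` set us \<inter> {M..c} = {}"
        then have "M \<notin> set us" using mem[of M] c by force
        moreover have "c = Suc M"
        proof (rule ccontr)
          assume "c \<noteq> Suc M"
          then have "Suc M < c" "Suc M \<in> set us" using c sub by auto
          with mem have "Suc M \<in> skip c ` set us" by blast
          with * \<open>Suc M < c\<close> show False by auto
        qed
        ultimately show "M \<notin> set us \<and> c = Suc M" by simp
      next
        assume *: "M \<notin> set us \<and> c = Suc M"
        then have "M \<notin> skip c ` set us" using mem by simp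
        moreover have "c \<notin> skip c ` set us" using range_skip[of c] by auto
        moreover have "{M..c} = {M, c}" using * by auto
        ultimately show "skip c ` set us \<inter> {M..c} = {}" by simp
      qed
      moreover have "length us < c" using len c by simp
      ultimately show ?thesis
        using c len W_skip[of us c] by (auto simp: W_def mult_ac)
    qed
    then have "(\<Sum>c\<in>{M<..M + k}. W (c # map (skip c) us)) =
        W us * (\<Sum>c\<in>{M<..M + k}. (if M \<in> set us then 1 else x) ^ of_bool (c = Suc M))"
      unfolding sum_distrib_left by (intro sum.cong) auto
    also have "\<dots> = W us * (of_nat (k - 1) + (if M \<in> set us then 1 else x))"
      using k by (subst sum_distinguished) simp_all
    finally show ?thesis .
  qed
  \<comment> \<open>These facts resolve the conditionals in \<open>small\<close> and
    \<open>large\<close> on the two parts produced by \<open>value_step\<close>.\<close>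
  have new: "M \<notin> set (map (skip M) zs)" for zs
    using range_skip[of M] by auto
  have old: "M \<in> set ys" if "ys \<in> partial_words m m (Suc j)" for ys j
    using that by (simp add: partial_words_Suc_value M_def)
  have len: "length zs < M" if "zs \<in> partial_words m m j" for zs j
    using that by (simp add: partial_words_def M_def)
  note value_step = sum_partial_words_value[of _ m m, folded M_def]
  have "(\<Sum>us\<in>partial_words m M k. \<Sum>c\<in>{1..M} - set us. W (c # us)) =
      (\<Sum>us\<in>partial_words m M k. W us * (of_nat k + (if M \<in> set us then y else 1)))"
    using small by (intro sum.cong) auto
  also have "\<dots> = (\<Sum>zs\<in>partial_words m m k. W zs * (of_nat k + 1)) +
      (\<Sum>ys\<in>partial_words m m (Suc k). W ys * (of_nat k + y))"
    unfolding value_step using new old len W_skip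
    by (intro arg_cong2[where f = "(+)"] sum.cong) auto
  finally have S: "(\<Sum>us\<in>partial_words m M k. \<Sum>c\<in>{1..M} - set us. W (c # us)) =
      (\<Sum>zs\<in>partial_words m m k. W zs * (of_nat k + 1)) +
      (\<Sum>ys\<in>partial_words m m (Suc k). W ys * (of_nat k + y))" .
  have L: "(\<Sum>us\<in>partial_words m M (k - 1). \<Sum>c\<in>{M<..M + k}. W (c # map (skip c) us)) =
      (\<Sum>zs\<in>partial_words m m (k - 1). W zs * (of_nat (k - 1) + x)) +
      (\<Sum>ys\<in>partial_words m m k. W ys * of_nat k)" if k: "k \<noteq> 0"
  proof -
    have k1: "Suc (k - 1) = k" "of_nat (k - 1) + 1 = (of_nat k :: 'a)"
      using k by (cases k; simp add: add.commute)+
    have "(\<Sum>us\<in>partial_words m M (k - 1). \<Sum>c\<in>{M<..M + k}. W (c # map (skip c) us)) =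
      (\<Sum>us\<in>partial_words m M (k - 1). W us * (of_nat (k - 1) + (if M \<in> set us then 1 else x)))"
      using large k by (intro sum.cong) auto
    also have "\<dots> = (\<Sum>zs\<in>partial_words m m (k - 1). W zs * (of_nat (k - 1) + x)) +
      (\<Sum>ys\<in>partial_words m m (Suc (k - 1)). W ys * (of_nat (k - 1) + 1))"
      unfolding value_step using new old len W_skip
      by (intro arg_cong2[where f = "(+)"] sum.cong) auto
    finally show ?thesis unfolding k1 .
  qed
  have "(\<Sum>ys\<in>partial_words M M k. W ys) =
      (\<Sum>zs\<in>partial_words m m k. W zs * (of_nat k + 1)) +
      (\<Sum>ys\<in>partial_words m m (Suc k). W ys * (of_nat k + y)) +
      (if k = 0 then 0 else (\<Sum>zs\<in>partial_words m m (k - 1). W zs * (of_nat (k - 1) + x)) +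
      (\<Sum>ys\<in>partial_words m m k. W ys * of_nat k))"
    unfolding M_def sum_partial_words_position using S L by (simp add: M_def)
  \<comment> \<open>A rise completes the product up to \<open>k\<close>; a fall leaves its last
    factor \<open>of_nat k + x\<close> over, which joins \<open>of_nat k + y\<close>.\<close>
  also have "\<dots> = (\<Prod>j<k. of_nat j + x) * jfrac x y M k"
    unfolding sum_distrib_right[symmetric] Suc.IH[folded W_def]
    by (cases k) (simp_all add: M_def mult_2 algebra_simps)
  finally show ?case unfolding W_def M_def .
qed

section \<open>Permutations\<close>

lemma card_filter_atLeastAtMost_Suc:
  "card {i \<in> {1..Suc m}. P i} = card {i \<in> {1..m}. P i} + of_bool (P (Suc m))"
proof -
  have "{i \<in> {1..Suc m}. P i} = {i \<in> {1..m}. P i} \<union> (if P (Suc m) then {Suc m} else {})"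
    by (auto simp: le_Suc_eq)
  then show ?thesis by auto
qed

definition word :: "nat \<Rightarrow> (nat \<Rightarrow> nat) \<Rightarrow> nat list" where
  "word n \<sigma> = rev (map \<sigma> [1..<Suc n])"

lemma word_Suc: "word (Suc n) \<sigma> = \<sigma> (Suc n) # word n \<sigma>"
  by (simp add: word_def)

lemma length_word [simp]: "length (word n \<sigma>) = n"
  by (simp add: word_def)

lemma set_word: "set (word n \<sigma>) = \<sigma> ` {1..<Suc n}"
  by (simp add: word_def del: upt_Suc)

text \<open>At \<open>k = 0\<close> the partial words are the injective words of length
  \<open>n\<close> over \<open>{1..n}\<close>. The map is injective, and both sides have
  \<open>fact n\<close> elements.\<close>

lemma bij_betw_word: "bij_betw (word n) {\<sigma>. \<sigma> permutes {1..n}} (partial_words n n 0)"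
proof -
  have eq: "partial_words n n 0 = {ys. length ys = n \<and> distinct ys \<and> set ys \<subseteq> {1..n}}"
    by (auto simp: partial_words_def)
  have "\<sigma> = \<tau>" if "\<sigma> permutes {1..n}" "\<tau> permutes {1..n}" "word n \<sigma> = word n \<tau>" for \<sigma> \<tau>
  proof
    fix i
    have "\<forall>j\<in>{1..<Suc n}. \<sigma> j = \<tau> j"
      using that(3) by (simp add: word_def map_eq_conv del: upt_Suc)
    then show "\<sigma> i = \<tau> i"
      using that(1,2) by (cases "i \<in> {1..n}") (auto simp: permutes_not_in)
  qed
  then have inj: "inj_on (word n) {\<sigma>. \<sigma> permutes {1..n}}"
    by (auto intro: inj_onI)
  have "word n \<sigma> \<in> partial_words n n 0" if "\<sigma> permutes {1..n}" for \<sigma>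
  proof -
    have "distinct (word n \<sigma>)"
      using permutes_inj_on[OF that] by (simp add: word_def distinct_map del: upt_Suc)
    moreover have "set (word n \<sigma>) = {1..n}"
      using permutes_image[OF that] by (simp add: set_word atLeastLessThanSuc_atLeastAtMost)
    ultimately show ?thesis by (simp add: eq)
  qed
  then have sub: "word n ` {\<sigma>. \<sigma> permutes {1..n}} \<subseteq> partial_words n n 0" by auto
  have "card (partial_words n n 0) = \<Prod>{1..n}"
    unfolding eq by (subst card_lists_distinct_length_eq) auto
  also have "\<dots> = card {\<sigma>. \<sigma> permutes {1..n}}"
    by (subst card_permutations[where n = n]) (auto simp: fact_prod)
  also have "\<dots> = card (word n ` {\<sigma>. \<sigma> permutes {1..n}})"
    by (rule card_image[OF inj, symmetric])
  finally have "word n ` {\<sigma>. \<sigma> permutes {1..n}} = partial_words n n 0"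
    using sub by (intro card_subset_eq finite_partial_words) auto
  with inj show ?thesis by (simp add: bij_betw_def)
qed

text \<open>Purity of \<open>i\<close> depends only on the values at positions up to
  \<open>i\<close>, so the recursion over prefixes counts it.\<close>

lemma word_pex_word: "word_pex (word n \<sigma>) = pex n \<sigma>"
proof -
  have "word_pex (word n \<sigma>) = card {i \<in> {1..n}. i < \<sigma> i \<and> \<sigma> ` {1..<i} \<inter> {i..\<sigma> i} = {}}"
    by (induction n)
      (simp_all only: word_Suc word_pex.simps card_filter_atLeastAtMost_Suc length_word set_word,
       simp add: word_def)
  moreover have "{i. pure_excedance n \<sigma> i} =
      {i \<in> {1..n}. i < \<sigma> i \<and> \<sigma> ` {1..<i} \<inter> {i..\<sigma> i} = {}}"
    by (auto simp: pure_excedance_def disjoint_iff)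
  ultimately show ?thesis by (simp add: pex_def)
qed

text \<open>
  A position \<open>i\<close> with \<open>\<sigma> i < i\<close> is never a record, so that exclusiveness imposes nothing on cycle
  peaks.
\<close>

lemma ear_eq_card:
  assumes \<sigma>: "\<sigma> permutes {1..n}"
  shows "ear n \<sigma> = card {i \<in> {1..n}. \<sigma> i < i \<and> i \<in> \<sigma> ` {1..<i} \<and> {1..<\<sigma> i} \<subseteq> \<sigma> ` {1..<i}}"
proof -
  have inj: "inj \<sigma>" using \<sigma> by (rule permutes_inj)
  have ran: "\<sigma> j \<in> {1..n} \<longleftrightarrow> j \<in> {1..n}" for j using \<sigma> by (rule permutes_in_image)
  have surj: "\<exists>u\<in>{1..n}. \<sigma> u = v" if "v \<in> {1..n}" for v
    using permutes_image[OF \<sigma>] that by (metis imageE)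
  have "exclusive_antirecord n \<sigma> i \<and> cycle_peak n \<sigma> i \<longleftrightarrow>
      \<sigma> i < i \<and> i \<in> \<sigma> ` {1..<i} \<and> {1..<\<sigma> i} \<subseteq> \<sigma> ` {1..<i}" if i: "i \<in> {1..n}" for i
  proof (cases "\<sigma> i < i")
    case True
    \<comment> \<open>For a record, the \<open>i - 1\<close> earlier values are distinct elements of
      \<open>{1..<\<sigma> i}\<close>, which is too small when
      \<open>\<sigma> i < i\<close>.\<close>
    have "\<not> is_record n \<sigma> i"
    proof
      assume "is_record n \<sigma> i"
      then have "\<sigma> ` {1..<i} \<subseteq> {1..<\<sigma> i}"
        using ran i by (fastforce simp: is_record_def)
      then have "card (\<sigma> ` {1..<i}) \<le> card {1..<\<sigma> i}" by (intro card_mono) auto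
      then have "i - 1 \<le> \<sigma> i - 1"
        using card_image[OF inj_on_subset[OF inj], of "{1..<i}"] by simp
      then show False using True ran[of i] i by auto
    qed
    moreover have "inv \<sigma> i < i \<longleftrightarrow> i \<in> \<sigma> ` {1..<i}"
    proof
      assume "inv \<sigma> i < i"
      moreover have "\<sigma> (inv \<sigma> i) = i" using \<sigma> by (simp add: permutes_inverses)
      ultimately show "i \<in> \<sigma> ` {1..<i}" using ran[of "inv \<sigma> i"] i by force
    next
      assume "i \<in> \<sigma> ` {1..<i}"
      then obtain u where "u < i" "i = \<sigma> u" by auto
      then show "inv \<sigma> i < i" using inj by simp
    qed
    \<comment> \<open>Every smaller value occurs somewhere; an antirecord forces its position to lie
      to the left of \<open>i\<close>.\<close>
    moreover have "antirecord n \<sigma> i \<longleftrightarrow> {1..<\<sigma> i} \<subseteq> \<sigma> ` {1..<i}"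
    proof
      assume a: "antirecord n \<sigma> i"
      show "{1..<\<sigma> i} \<subseteq> \<sigma> ` {1..<i}"
      proof
        fix v assume v: "v \<in> {1..<\<sigma> i}"
        with surj[of v] ran[of i] i obtain u where u: "u \<in> {1..n}" "\<sigma> u = v" by auto
        have "\<not> i < u"
        proof
          assume "i < u"
          with u have "u \<in> {i<..n}" by simp
          with a have "\<sigma> i < \<sigma> u" unfolding antirecord_def by blast
          with u v show False by simp
        qed
        moreover have "u \<noteq> i" using u v by auto
        ultimately show "v \<in> \<sigma> ` {1..<i}" using u by auto
      qed
    next
      assume s: "{1..<\<sigma> i} \<subseteq> \<sigma> ` {1..<i}"
      have "\<sigma> i < \<sigma> j" if j: "j \<in> {i<..n}" for j
      proof (rule ccontr)
        assume "\<not> \<sigma> i < \<sigma> j"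
        moreover have "\<sigma> j \<noteq> \<sigma> i" using inj_eq[OF inj] j by auto
        moreover have "\<sigma> j \<ge> 1" using ran[of j] j i by auto
        ultimately have "\<sigma> j \<in> \<sigma> ` {1..<i}" using s by auto
        then show False using inj_image_mem_iff[OF inj] j by auto
      qed
      then show "antirecord n \<sigma> i" using i by (simp add: antirecord_def)
    qed
    ultimately show ?thesis
      using True i by (auto simp: exclusive_antirecord_def cycle_peak_def)
  qed (auto simp: cycle_peak_def)
  then have "{i. exclusive_antirecord n \<sigma> i \<and> cycle_peak n \<sigma> i} =
      {i \<in> {1..n}. \<sigma> i < i \<and> i \<in> \<sigma> ` {1..<i} \<and> {1..<\<sigma> i} \<subseteq> \<sigma> ` {1..<i}}"
    by (auto simp: cycle_peak_def)
  then show ?thesis by (simp add: ear_def)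
qed

lemma word_ear_word:
  assumes "\<sigma> permutes {1..n}"
  shows "word_ear (word n \<sigma>) = ear n \<sigma>"
proof -
  have "word_ear (word n \<sigma>) =
      card {i \<in> {1..n}. \<sigma> i < i \<and> i \<in> \<sigma> ` {1..<i} \<and> {1..<\<sigma> i} \<subseteq> \<sigma> ` {1..<i}}"
    by (induction n)
      (simp_all only: word_Suc word_ear.simps card_filter_atLeastAtMost_Suc length_word set_word,
       simp add: word_def)
  then show ?thesis using ear_eq_card[OF assms] by simp
qed

lemma sum_pex_ear:
  fixes x y :: "'a::comm_semiring_1"
  shows "(\<Sum>\<sigma> | \<sigma> permutes {1..n}. x ^ pex n \<sigma> * y ^ ear n \<sigma>) = jfrac x y n 0"
proof -
  have "(\<Sum>\<sigma> | \<sigma> permutes {1..n}. x ^ pex n \<sigma> * y ^ ear n \<sigma>) =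
      (\<Sum>\<sigma> | \<sigma> permutes {1..n}. x ^ word_pex (word n \<sigma>) * y ^ word_ear (word n \<sigma>))"
    by (simp add: word_pex_word word_ear_word)
  also have "\<dots> = (\<Sum>ys\<in>partial_words n n 0. x ^ word_pex ys * y ^ word_ear ys)"
    using bij_betw_word by (rule sum.reindex_bij_betw)
  \<comment> \<open>At height \<open>0\<close> the product in front is empty.\<close>
  finally show ?thesis using sum_partial_words_pex_ear[of x y n 0] by simp
qed

section \<open>Permutations as complete partial injections\<close>

definition graph_on :: "nat \<Rightarrow> (nat \<Rightarrow> nat) \<Rightarrow> nat rel" where
  "graph_on n \<sigma> = (\<lambda>i. (i, \<sigma> i)) ` {1..n}"

lemma mem_graph_on [simp]: "(i, j) \<in> graph_on n \<sigma> \<longleftrightarrow> i \<in> {1..n} \<and> j = \<sigma> i"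
  by (auto simp: graph_on_def)

text \<open>With \<open>n\<close> links on \<open>n\<close> elements no open path remains, so the
  relation is total in both directions.\<close>

lemma bij_betw_graph_on:
  "bij_betw (graph_on n) {\<sigma>. \<sigma> permutes {1..n}} {r \<in> pinj {1..n} {1..n}. card r = n}"
proof (rule bij_betw_imageI)
  show "inj_on (graph_on n) {\<sigma>. \<sigma> permutes {1..n}}"
  proof (rule inj_onI, rule ext)
    fix \<sigma> \<tau> i assume \<sigma>\<tau>: "\<sigma> \<in> {\<sigma>. \<sigma> permutes {1..n}}" "\<tau> \<in> {\<sigma>. \<sigma> permutes {1..n}}"
      and eq: "graph_on n \<sigma> = graph_on n \<tau>"
    show "\<sigma> i = \<tau> i"
    proof (cases "i \<in> {1..n}")
      case True
      then have "(i, \<sigma> i) \<in> graph_on n \<tau>" using eq by (metis mem_graph_on)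
      then show ?thesis by simp
    next
      case False
      with \<sigma>\<tau> show ?thesis by (simp add: permutes_not_in)
    qed
  qed
  show "graph_on n ` {\<sigma>. \<sigma> permutes {1..n}} = {r \<in> pinj {1..n} {1..n}. card r = n}"
  proof (intro equalityI subsetI)
    fix r assume "r \<in> graph_on n ` {\<sigma>. \<sigma> permutes {1..n}}"
    then obtain \<sigma> where \<sigma>: "\<sigma> permutes {1..n}" and r: "r = graph_on n \<sigma>" by auto
    have "card r = n"
      unfolding r graph_on_def by (subst card_image) (auto simp: inj_on_def)
    moreover have "r \<in> pinj {1..n} {1..n}"
      using permutes_in_image[OF \<sigma>] permutes_inj[OF \<sigma>]
      unfolding r pinj_def single_valued_def graph_on_def by (auto dest: injD)
    ultimately show "r \<in> {r \<in> pinj {1..n} {1..n}. card r = n}" by simp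
  next
    fix r assume "r \<in> {r \<in> pinj {1..n} {1..n}. card r = n}"
    then have r: "r \<in> pinj {1..n} {1..n}" and card: "card r = n" by auto
    then have sub: "r \<subseteq> {1..n} \<times> {1..n}" and sv: "single_valued r" "single_valued (r\<inverse>)"
      unfolding pinj_def by auto
    have "card ({1..n} - Domain r) = 0" "card ({1..n} - Range r) = 0"
      using pinj_card_Diff[OF _ r] card by auto
    then have dom: "{1..n} \<subseteq> Domain r" and ran: "{1..n} \<subseteq> Range r" by auto
    \<comment> \<open>The identity outside \<open>{1..n}\<close> is what \<open>permutes\<close>
      demands.\<close>
    define \<sigma> where "\<sigma> i = (if i \<in> {1..n} then THE j. (i, j) \<in> r else i)" for i
    have \<sigma>: "(i, j) \<in> r \<longleftrightarrow> i \<in> {1..n} \<and> j = \<sigma> i" for i j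
    proof (cases "i \<in> {1..n}")
      case True
      with dom obtain j' where j': "(i, j') \<in> r" by auto
      then have "\<sigma> i = j'" using True sv(1) by (auto simp: \<sigma>_def single_valued_def)
      then show ?thesis using True j' sv(1) by (auto simp: single_valued_def)
    qed (use sub in auto)
    have "bij_betw \<sigma> {1..n} {1..n}"
    proof (rule bij_betw_imageI)
      show "inj_on \<sigma> {1..n}"
        using sv(2) \<sigma> unfolding inj_on_def single_valued_def by (metis converse_iff)
      show "\<sigma> ` {1..n} = {1..n}"
      proof (intro equalityI subsetI)
        fix j assume "j \<in> {1..n}"
        with ran obtain i where "(i, j) \<in> r" by auto
        then show "j \<in> \<sigma> ` {1..n}" using \<sigma> by auto
      next
        fix j assume "j \<in> \<sigma> ` {1..n}"
        then obtain i where "(i, j) \<in> r" using \<sigma> by auto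
        then show "j \<in> {1..n}" using sub by auto
      qed
    qed
    then have "\<sigma> permutes {1..n}"
      by (rule bij_imp_permutes) (auto simp: \<sigma>_def)
    moreover have "r = graph_on n \<sigma>"
      using \<sigma> unfolding set_eq_iff split_paired_All mem_graph_on by blast
    ultimately show "r \<in> graph_on n ` {\<sigma>. \<sigma> permutes {1..n}}" by auto
  qed
qed

text \<open>The reachable sets of the graph are the orbits. Orbits of fixed points are distinct
  singletons, disjoint from the family of orbits of moved points, so the subtraction in
  \<open>pcyc\<close> leaves exactly the latter.\<close>

lemma card_nontrivial_cycles_graph_on:
  assumes \<sigma>: "\<sigma> permutes {1..n}"
  shows "card (nontrivial_cycles (graph_on n \<sigma>)) = pcyc n \<sigma>"
proof -
  let ?r = "graph_on n \<sigma>" and ?F = "{i \<in> {1..n}. \<sigma> i = i}" and ?N = "{i \<in> {1..n}. \<sigma> i \<noteq> i}"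
  have ran: "\<sigma> j \<in> {1..n} \<longleftrightarrow> j \<in> {1..n}" for j using \<sigma> by (rule permutes_in_image)
  have self: "i \<in> orbit \<sigma> i" for i
    using \<sigma> by (intro permutation_self_in_orbit) (metis permutation_permutes finite_atLeastAtMost)
  have orbit: "?r\<^sup>+ `` {i} = orbit \<sigma> i" if i: "i \<in> {1..n}" for i
  proof (intro equalityI subsetI)
    fix j assume "j \<in> ?r\<^sup>+ `` {i}"
    then have "(i, j) \<in> ?r\<^sup>+" by auto
    then show "j \<in> orbit \<sigma> i"
      by (induction rule: trancl_induct) (auto intro: orbit.intros)
  next
    fix j assume "j \<in> orbit \<sigma> i"
    then have "(i, j) \<in> ?r\<^sup>+ \<and> j \<in> {1..n}"
    proof (induction rule: orbit.induct)
      case base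
      then show ?case using i ran[of i] by (auto intro: r_into_trancl)
    next
      case (step j)
      then have "(j, \<sigma> j) \<in> ?r" "\<sigma> j \<in> {1..n}" using ran[of j] by auto
      then show ?case using step by (auto intro: trancl_into_trancl)
    qed
    then show "j \<in> ?r\<^sup>+ `` {i}" by auto
  qed
  have cyclic: "(i, i) \<in> ?r\<^sup>+ \<longleftrightarrow> i \<in> {1..n}" for i
  proof
    assume "(i, i) \<in> ?r\<^sup>+"
    then show "i \<in> {1..n}" by (auto dest: tranclD)
  next
    assume "i \<in> {1..n}"
    then show "(i, i) \<in> ?r\<^sup>+" using orbit self by blast
  qed
  have N: "nontrivial_cycles ?r = orbit \<sigma> ` ?N"
  proof -
    have "nontrivial_cycles ?r = (\<lambda>i. ?r\<^sup>+ `` {i}) ` ?N"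
      unfolding nontrivial_cycles_def cyclic by auto
    also have "\<dots> = orbit \<sigma> ` ?N" using orbit by (intro image_cong) auto
    finally show ?thesis .
  qed
  have fixed: "orbit \<sigma> i = {i}" if "i \<in> ?F" for i
    using that by (simp add: orbit_eq_singleton_iff)
  have "inj_on (orbit \<sigma>) ?F" using fixed by (auto intro!: inj_onI)
  then have F: "card (orbit \<sigma> ` ?F) = fixpts n \<sigma>" by (simp add: card_image fixpts_def)
  have "orbit \<sigma> ` ?F \<inter> orbit \<sigma> ` ?N = {}"
  proof (rule ccontr)
    assume "orbit \<sigma> ` ?F \<inter> orbit \<sigma> ` ?N \<noteq> {}"
    then obtain i j where ij: "i \<in> ?F" "j \<in> ?N" "orbit \<sigma> j = orbit \<sigma> i" by auto
    then have "orbit \<sigma> j = {i}" using fixed by metis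
    then have "j = i" using self[of j] by auto
    then show False using ij by auto
  qed
  moreover have "orbit \<sigma> ` {1..n} = orbit \<sigma> ` ?F \<union> orbit \<sigma> ` ?N" by auto
  ultimately have "cyc n \<sigma> = fixpts n \<sigma> + card (orbit \<sigma> ` ?N)"
    unfolding cyc_def using F by (simp add: card_Un_disjoint)
  then show ?thesis by (simp add: N pcyc_def)
qed

text \<open>The insertion order \<open>zs\<close> is arbitrary: every order gives a statistic with
  the same joint distribution with \<open>pcyc\<close>.\<close>

lemma sum_min_peaks_pcyc:
  fixes x y :: "'a::comm_semiring_1" and s :: "(nat \<Rightarrow> nat) \<Rightarrow> nat"
  assumes zs: "distinct zs" "set zs = {1..n}"
    and s: "\<And>\<sigma>. \<sigma> permutes {1..n} \<Longrightarrow> s \<sigma> = min_peaks zs (graph_on n \<sigma>)"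
  shows "(\<Sum>\<sigma> | \<sigma> permutes {1..n}. x ^ s \<sigma> * y ^ pcyc n \<sigma>) = jfrac x y n 0"
proof -
  have len: "length zs = n" using zs distinct_card by fastforce
  let ?w = "\<lambda>r. x ^ min_peaks zs r * y ^ card (nontrivial_cycles r)"
  have "(\<Sum>\<sigma> | \<sigma> permutes {1..n}. x ^ s \<sigma> * y ^ pcyc n \<sigma>) =
      (\<Sum>\<sigma> | \<sigma> permutes {1..n}. ?w (graph_on n \<sigma>))"
    using s by (simp add: card_nontrivial_cycles_graph_on)
  also have "\<dots> = (\<Sum>r\<in>{r \<in> pinj {1..n} {1..n}. card r = n}. ?w r)"
    using bij_betw_graph_on by (rule sum.reindex_bij_betw)
  also have "\<dots> = (\<Sum>r\<in>pinj {1..n} {1..n}. of_bool (card r + 0 = n) * ?w r)"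
    by (rule sum.mono_neutral_cong_left) (auto simp: finite_pinj)
  also have "\<dots> = jfrac x y n 0"
    using sum_min_peaks_cycles[OF zs(1), of 0 x y] by (simp only: zs(2) len)
  finally show ?thesis .
qed

section \<open>The two insertion orders that yield \<open>ear\<close> and \<open>pex\<close>\<close>

lemma ear_eq_min_peaks:
  assumes \<sigma>: "\<sigma> permutes {1..n}"
  shows "ear n \<sigma> = min_peaks (rev [1..<Suc n]) (graph_on n \<sigma>)"
proof -
  have ran: "\<sigma> j \<in> {1..n} \<longleftrightarrow> j \<in> {1..n}" for j using \<sigma> by (rule permutes_in_image)
  have peaks: "min_peaks (rev [1..<Suc m]) r = card {i \<in> {1..m}. min_peak i {1..<i} r}" for m r
  proof (induction m)
    case (Suc m)
    have "rev [1..<Suc (Suc m)] = Suc m # rev [1..<Suc m]" by simp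
    then show ?case
      by (simp only: min_peaks.simps Suc card_filter_atLeastAtMost_Suc set_rev set_upt)
  qed simp
  \<comment> \<open>The elements inserted before \<open>i\<close> are the smaller ones: both
    neighbours of \<open>i\<close> being smaller is a cycle peak, and \<open>\<sigma> i\<close>
    being the least free initial point is the antirecord condition.\<close>
  have "min_peak i {1..<i} (graph_on n \<sigma>) \<longleftrightarrow>
      \<sigma> i < i \<and> i \<in> \<sigma> ` {1..<i} \<and> {1..<\<sigma> i} \<subseteq> \<sigma> ` {1..<i}" if i: "i \<in> {1..n}" for i
  proof -
    have "graph_on n \<sigma> `` {1..<i} = \<sigma> ` {1..<i}"
      using i by (auto simp: Image_def)
    moreover have "\<sigma> i \<ge> 1" using ran[of i] i by auto
    ultimately show ?thesis
      using i unfolding min_peak_def by (auto simp: subset_iff)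
  qed
  then have "{i \<in> {1..n}. min_peak i {1..<i} (graph_on n \<sigma>)} =
      {i \<in> {1..n}. \<sigma> i < i \<and> i \<in> \<sigma> ` {1..<i} \<and> {1..<\<sigma> i} \<subseteq> \<sigma> ` {1..<i}}"
    by blast
  then show ?thesis by (simp only: ear_eq_card[OF \<sigma>] peaks)
qed

text \<open>In the order from \<open>n\<close> down to \<open>1\<close> the elements inserted before
  \<open>i\<close> are the larger ones. Values in \<open>{i..<\<sigma> i}\<close> being taken at
  later positions is the same as their not being taken earlier, which is purity.\<close>

lemma pex_eq_min_peaks:
  assumes \<sigma>: "\<sigma> permutes {1..n}"
  shows "pex n \<sigma> = min_peaks [1..<Suc n] (graph_on n \<sigma>)"
proof -
  have inj: "inj \<sigma>" using \<sigma> by (rule permutes_inj)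
  have ran: "\<sigma> j \<in> {1..n} \<longleftrightarrow> j \<in> {1..n}" for j using \<sigma> by (rule permutes_in_image)
  have surj: "\<exists>u\<in>{1..n}. \<sigma> u = v" if "v \<in> {1..n}" for v
    using permutes_image[OF \<sigma>] that by (metis imageE)
  have peaks: "min_peaks [m..<Suc n] r = card {i \<in> {m..n}. min_peak i {i<..n} r}"
    if "m \<le> Suc n" for m r
    using that
  proof (induction m rule: inc_induct)
    case (step m)
    have "[m..<Suc n] = m # [Suc m..<Suc n]" using step.hyps by (intro upt_conv_Cons) auto
    moreover have "set [Suc m..<Suc n] = {m<..n}" by auto
    moreover have "{i \<in> {m..n}. min_peak i {i<..n} r} = {i \<in> {Suc m..n}. min_peak i {i<..n} r} \<union>
        (if min_peak m {m<..n} r then {m} else {})"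
      using step.hyps by (auto simp: le_Suc_eq Suc_le_eq order.order_iff_strict)
    ultimately show ?case using step.IH by auto
  qed auto
  have "pure_excedance n \<sigma> i \<longleftrightarrow> min_peak i {i<..n} (graph_on n \<sigma>)" if i: "i \<in> {1..n}" for i
  proof -
    have img: "graph_on n \<sigma> `` {i<..n} = \<sigma> ` {i<..n}"
      using i by (auto simp: Image_def)
    have later: "v \<in> \<sigma> ` {i<..n} \<longleftrightarrow> v \<notin> \<sigma> ` {1..<i} \<and> v \<noteq> \<sigma> i" if range: "v \<in> {1..n}" for v
    proof
      assume "v \<in> \<sigma> ` {i<..n}"
      then obtain u where u: "i < u" "v = \<sigma> u" by auto
      then show "v \<notin> \<sigma> ` {1..<i} \<and> v \<noteq> \<sigma> i"
        by (auto simp: inj_image_mem_iff[OF inj] inj_eq[OF inj])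
    next
      assume v: "v \<notin> \<sigma> ` {1..<i} \<and> v \<noteq> \<sigma> i"
      obtain u where u: "u \<in> {1..n}" "\<sigma> u = v" using surj[OF range] by auto
      with v have "u \<notin> {1..<i}" "u \<noteq> i" by auto
      with u show "v \<in> \<sigma> ` {i<..n}" by auto
    qed
    have \<sigma>i: "\<sigma> i \<in> {1..n}" using ran i by simp
    have self: "\<sigma> i \<notin> \<sigma> ` {1..<i}" by (auto simp: inj_image_mem_iff[OF inj])
    have "min_peak i {i<..n} (graph_on n \<sigma>) \<longleftrightarrow>
        i < \<sigma> i \<and> i \<in> \<sigma> ` {i<..n} \<and> (\<forall>v\<in>{i<..<\<sigma> i}. v \<in> \<sigma> ` {i<..n})"
      using i \<sigma>i unfolding min_peak_def img by auto
    \<comment> \<open>The condition that \<open>i\<close> has a larger predecessor becomes the case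
      \<open>v = i\<close>.\<close>
    also have "\<dots> \<longleftrightarrow> i < \<sigma> i \<and> (\<forall>v\<in>{i..<\<sigma> i}. v \<in> \<sigma> ` {i<..n})"
      by (auto simp: le_less)
    also have "\<dots> \<longleftrightarrow> i < \<sigma> i \<and> (\<forall>v\<in>{i..<\<sigma> i}. v \<notin> \<sigma> ` {1..<i})"
      using later i \<sigma>i by auto
    \<comment> \<open>The end point \<open>\<sigma> i\<close> may be added since by injectivity no
      earlier position takes it.\<close>
    also have "\<dots> \<longleftrightarrow> i < \<sigma> i \<and> (\<forall>v\<in>{i..\<sigma> i}. v \<notin> \<sigma> ` {1..<i})"
    proof (cases "i < \<sigma> i")
      case True
      then have "{i..\<sigma> i} = insert (\<sigma> i) {i..<\<sigma> i}" by auto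
      then show ?thesis using self by (simp only: ball_simps) blast
    qed simp
    also have "\<dots> \<longleftrightarrow> pure_excedance n \<sigma> i"
      using i unfolding pure_excedance_def by auto
    finally show ?thesis by simp
  qed
  then have "{i. pure_excedance n \<sigma> i} = {i \<in> {1..n}. min_peak i {i<..n} (graph_on n \<sigma>)}"
    by (auto simp: pure_excedance_def)
  then show ?thesis using peaks[of 1] by (simp add: pex_def)
qed

section \<open>The pairs with \<open>pcyc\<close> and the conclusion\<close>

lemma sum_ear_pcyc:
  fixes x y :: "'a::comm_semiring_1"
  shows "(\<Sum>\<sigma> | \<sigma> permutes {1..n}. x ^ ear n \<sigma> * y ^ pcyc n \<sigma>) = jfrac x y n 0"
proof (rule sum_min_peaks_pcyc)
  show "set (rev [1..<Suc n]) = {1..n}" by (simp add: atLeastLessThanSuc_atLeastAtMost del: upt_Suc)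
qed (simp, rule ear_eq_min_peaks)

lemma sum_pex_pcyc:
  fixes x y :: "'a::comm_semiring_1"
  shows "(\<Sum>\<sigma> | \<sigma> permutes {1..n}. x ^ pex n \<sigma> * y ^ pcyc n \<sigma>) = jfrac x y n 0"
proof (rule sum_min_peaks_pcyc)
  show "set ([1..<Suc n]) = {1..n}" by (simp add: atLeastLessThanSuc_atLeastAtMost del: upt_Suc)
qed (simp, rule pex_eq_min_peaks)

theorem corollary1p4:
  fixes n :: nat
  assumes "n \<ge> 1"
  shows "bistat_poly n pex ear = bistat_poly n ear pex \<and>
         bistat_poly n ear pex = bistat_poly n ear pcyc \<and>
         bistat_poly n ear pcyc = bistat_poly n pcyc ear \<and>
         bistat_poly n pcyc ear = bistat_poly n pex pcyc \<and>
         bistat_poly n pex pcyc = bistat_poly n pcyc pex"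
proof -
  \<comment> \<open>Exchanging the two indeterminates in the identity for \<open>(s, t)\<close>
    gives the one for \<open>(t, s)\<close>, and \<open>jfrac\<close> is symmetric in them.\<close>
  have key: "bistat_poly n s t = jfrac var_x var_y n 0 \<and> bistat_poly n t s = jfrac var_x var_y n 0"
    if "\<And>x y :: int poly poly. (\<Sum>\<sigma> | \<sigma> permutes {1..n}. x ^ s n \<sigma> * y ^ t n \<sigma>) = jfrac x y n 0"
    for s t
    using that[of var_x var_y] that[of var_y var_x]
    by (simp add: bistat_poly_def jfrac_commute[of var_y] mult.commute)
  show ?thesis
    using key[where s = pex and t = ear, OF sum_pex_ear]
      key[where s = ear and t = pcyc, OF sum_ear_pcyc]
      key[where s = pex and t = pcyc, OF sum_pex_pcyc] by simp
qed

end
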